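(* Let $A_i\in\mathbb{R}^{n\times n}$ and $B_i\in\mathbb{R}^{n\times m}$ for $i\in\{1,\dots,M\}$, consider the controlled switched linear system $x_{k+1}=A_{\sigma(k)}x_k+B_{\sigma(k)}u_k$, $k\in\mathbb{N}$, a cost function $\tilde c:\mathbb{R}^n\times\mathbb{R}^m\to\mathbb{R}_{\ge0}$, a directed labeled graph $\mathcal{G}=(\mathcal{S},\mathcal{E})$ with labels in $\{1,\dots,M\}$, and a set $\mathcal{T}$ of functions from $\mathbb{R}^n$ to $\mathbb{R}_{\ge0}$. Assume that $\mathcal{G}$ is complete for $\{1,\dots,M\}$ and that $\{V_\alpha\}_{\alpha\in\mathcal{S}}\subseteq\mathcal{T}$ and $\{K_\alpha\}_{\alpha\in\mathcal{S}}\subseteq\mathbb{R}^{m\times n}$ satisfy $$V_\alpha(x)\ge\tilde c(x,K_\alpha x)+V_\beta(A_ix+B_iK_\alpha x),\qquad\forall x\in\mathbb{R}^n,\ \forall(\alpha,\beta,i)\in\mathcal{E}.$$ Let $V(x):=\min_{\alpha\in\mathcal{S}}V_\alpha(x)$, and let $\phi:\mathbb{R}^n\to\mathbb{R}^m$ be defined by $\phi(x)=K_{\kappa(x)}x$, where $\kappa:\mathbb{R}^n\to\mathcal{S}$ satisfies $\kappa(x)\in\arg\min_{\alpha\in\mathcal{S}}V_\alpha(x)$ for all $x$. Then, for all $x\in\mathbb{R}^n$, $$V(x)\ge J^\phi(x)\ge J^*(x),$$ where $J^\phi$ is the closed-loop value function of the system with cost $\tilde c$ and policy $\phi$, and $J^*$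 is the optimal value function of the system with cost $\tilde c$.
   Context: $\mathbb{N}$ includes $0$ and $M\ge1$. A switching signal is any function $\sigma:\mathbb{N}\to\{1,\dots,M\}$. Given a feedback policy, i.e. any function $\phi:\mathbb{R}^n\to\mathbb{R}^m$, the closed-loop value function is $$J^\phi(x)=\sup_{\sigma:\mathbb{N}\to\{1,\dots,M\}}\ \sum_{k=0}^\infty\tilde c(x_k,\phi(x_k))\in[0,+\infty],\qquad x_0=x,\quad x_{k+1}=A_{\sigma(k)}x_k+B_{\sigma(k)}\phi(x_k),$$ where the sum is $+\infty$ if the series diverges. The optimal value function is $J^*(x)=\inf_{\phi:\mathbb{R}^n\to\mathbb{R}^m}J^\phi(x)$, the infimum being taken pointwise over all feedback policies. A directed labeled graph $\mathcal{G}=(\mathcal{S},\mathcal{E})$ consists of a finite (nonempty) set $\mathcal{S}$ of nodes and a set $\mathcal{E}\subseteq\mathcal{S}\times\mathcal{S}\times\{1,\dots,M\}$ of labeled edges; $(\alpha,\beta,i)$ is an edge from $\alpha$ to $\beta$ with label $i$. $\mathcal{G}$ is complete if for each $\alpha\in\mathcal{S}$ and each $i\in\{1,\dots,M\}$ there is at least one $\beta\in\mathcal{S}$ with $(\alpha,\beta,i)\in\mathcal{E}$. *)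

theory Defs
  imports "HOL-Analysis.Analysis"
begin

definition switching_signals :: "nat \<Rightarrow> (nat \<Rightarrow> nat) set" where
  "switching_signals M = {\<sigma>. \<forall>k. \<sigma> k \<in> {1..M}}"

primrec closed_loop ::
  "(nat \<Rightarrow> real^'n^'n) \<Rightarrow> (nat \<Rightarrow> real^'m^'n) \<Rightarrow> (real^'n \<Rightarrow> real^'m) \<Rightarrow>
   (nat \<Rightarrow> nat) \<Rightarrow> real^'n \<Rightarrow> nat \<Rightarrow> real^'n" where
  "closed_loop A B \<phi> \<sigma> x 0 = x"
| "closed_loop A B \<phi> \<sigma> x (Suc k) =
     A (\<sigma> k) *v closed_loop A B \<phi> \<sigma> x k + B (\<sigma> k) *v \<phi> (closed_loop A B \<phi> \<sigma> x k)"

text \<open>The series is taken in \<^typ>\<open>ennreal\<close>, so it is infinite exactly when the real series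
  diverges. The coercion \<^const>\<open>ennreal\<close> sends negative reals to 0, so the definition is
  meant for nonnegative costs only.\<close>

definition closed_loop_value ::
  "nat \<Rightarrow> (nat \<Rightarrow> real^'n^'n) \<Rightarrow> (nat \<Rightarrow> real^'m^'n) \<Rightarrow> (real^'n \<Rightarrow> real^'m \<Rightarrow> real) \<Rightarrow>
   (real^'n \<Rightarrow> real^'m) \<Rightarrow> real^'n \<Rightarrow> ennreal" where
  "closed_loop_value M A B c \<phi> x =
     (SUP \<sigma>\<in>switching_signals M.
        \<Sum>k. ennreal (c (closed_loop A B \<phi> \<sigma> x k) (\<phi> (closed_loop A B \<phi> \<sigma> x k))))"

definition optimal_value ::
  "nat \<Rightarrow> (nat \<Rightarrow> real^'n^'n) \<Rightarrow> (nat \<Rightarrow> real^'m^'n) \<Rightarrow> (real^'n \<Rightarrow> real^'m \<Rightarrow> real) \<Rightarrow>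
   real^'n \<Rightarrow> ennreal" where
  "optimal_value M A B c x = (INF \<phi>. closed_loop_value M A B c \<phi> x)"

definition labeled_graph :: "nat \<Rightarrow> 's set \<Rightarrow> ('s \<times> 's \<times> nat) set \<Rightarrow> bool" where
  "labeled_graph M S E \<longleftrightarrow> finite S \<and> S \<noteq> {} \<and> E \<subseteq> S \<times> S \<times> {1..M}"

definition complete_graph :: "nat \<Rightarrow> 's set \<Rightarrow> ('s \<times> 's \<times> nat) set \<Rightarrow> bool" where
  "complete_graph M S E \<longleftrightarrow> (\<forall>\<alpha>\<in>S. \<forall>i\<in>{1..M}. \<exists>\<beta>\<in>S. (\<alpha>, \<beta>, i) \<in> E)"

end

theory Submission
  imports Defs
begin

text \<open>
  The pointwise minimum of the functions \<open>V \<alpha>\<close> is a common Lyapunov function for the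
  greedy policy. At a state \<open>x\<close> the policy applies the gain of a node \<open>\<kappa> x\<close> that attains the
  minimum. Whatever mode \<open>i\<close> the switching signal then chooses, completeness provides an edge
  with label \<open>i\<close> from \<open>\<kappa> x\<close> to some \<open>\<beta>\<close>, and the edge inequality leaves at the successor state
  a value of \<open>V \<beta>\<close> that has dropped by at least the stage cost; the minimum there is no larger
  (\<open>min_decreases_under_greedy_policy\<close>). The edge taken may depend on the state and the mode,
  so no path in the graph has to be tracked along the trajectory.

  Such a decrease under every mode, telescoped along a trajectory, bounds every partial sum
  of the costs by the initial value of the Lyapunov function, uniformly in the switching
  signal (\<open>closed_loop_value_le_Lyapunov\<close>). The comparison with the optimal value is the fact
  that an infimum lies below each of its members.
\<close>

text \<open>
  The term \<open>W\<close> at the state reached after \<open>N\<close> steps turns the telescoping estimate into an invariant;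
  it is dropped, being nonnegative, when the series is bounded.
\<close>

lemma closed_loop_cost_telescope:
  fixes W :: "real^'n \<Rightarrow> real"
  assumes decrease: "\<And>x i. i \<in> {1..M} \<Longrightarrow> c x (\<phi> x) + W (A i *v x + B i *v \<phi> x) \<le> W x"
    and \<sigma>: "\<sigma> \<in> switching_signals M"
  shows "(\<Sum>k<N. c (closed_loop A B \<phi> \<sigma> x k) (\<phi> (closed_loop A B \<phi> \<sigma> x k)))
           + W (closed_loop A B \<phi> \<sigma> x N) \<le> W x"
proof (induction N)
  case 0
  show ?case by simp
next
  case (Suc N)
  have "\<sigma> N \<in> {1..M}"
    using \<sigma> by (simp add: switching_signals_def)
  from decrease[OF this, of "closed_loop A B \<phi> \<sigma> x N"] Suc show ?case
    by simp
qed

lemma closed_loop_value_le_Lyapunov: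
  fixes W :: "real^'n \<Rightarrow> real"
  assumes cost_nonneg: "\<And>x u. 0 \<le> c x u"
    and W_nonneg: "\<And>x. 0 \<le> W x"
    and decrease: "\<And>x i. i \<in> {1..M} \<Longrightarrow> c x (\<phi> x) + W (A i *v x + B i *v \<phi> x) \<le> W x"
  shows "closed_loop_value M A B c \<phi> x \<le> ennreal (W x)"
  unfolding closed_loop_value_def
proof (rule SUP_least)
  fix \<sigma> assume \<sigma>: "\<sigma> \<in> switching_signals M"
  let ?cost = "\<lambda>k. c (closed_loop A B \<phi> \<sigma> x k) (\<phi> (closed_loop A B \<phi> \<sigma> x k))"
  show "(\<Sum>k. ennreal (?cost k)) \<le> ennreal (W x)"
  proof (rule suminf_le_const[OF summableI])
    fix N
    have "(\<Sum>k<N. ?cost k) \<le> W x"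
      using closed_loop_cost_telescope[of M c \<phi> W A B, OF decrease \<sigma>, of x N]
        W_nonneg[of "closed_loop A B \<phi> \<sigma> x N"]
      by linarith
    then show "(\<Sum>k<N. ennreal (?cost k)) \<le> ennreal (W x)"
      by (simp add: cost_nonneg sum_ennreal ennreal_leI)
  qed
qed

text \<open>
  The gain is fixed before the mode \<open>i\<close> is known, so the bound has to hold for every mode with
  the same node \<open>a\<close>: completeness supplies a suitable edge out of \<open>a\<close> after the mode is
  revealed, and taking the minimum at the successor removes the dependence on its endpoint.
\<close>

lemma min_decreases_under_greedy_policy:
  fixes V :: "'s \<Rightarrow> real^'n \<Rightarrow> real" and K :: "'s \<Rightarrow> real^'n^'m"
  assumes graph: "labeled_graph M S E"
    and complete: "complete_graph M S E"
    and edge: "\<And>x \<alpha> \<beta> i. (\<alpha>, \<beta>, i) \<in> E \<Longrightarrow>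
           c x (K \<alpha> *v x) + V \<beta> (A i *v x + B i *v (K \<alpha> *v x)) \<le> V \<alpha> x"
    and greedy: "is_arg_min (\<lambda>\<alpha>. V \<alpha> x) (\<lambda>\<alpha>. \<alpha> \<in> S) a"
    and i: "i \<in> {1..M}"
  shows "c x (K a *v x) + Min ((\<lambda>\<alpha>. V \<alpha> (A i *v x + B i *v (K a *v x))) ` S)
           \<le> Min ((\<lambda>\<alpha>. V \<alpha> x) ` S)"
proof -
  let ?y = "A i *v x + B i *v (K a *v x)"
  have fin: "finite S"
    using graph by (simp add: labeled_graph_def)
  have "a \<in> S" and least: "\<And>\<alpha>. \<alpha> \<in> S \<Longrightarrow> V a x \<le> V \<alpha> x"
    using greedy by (auto simp: is_arg_min_linorder)
  obtain \<beta> where "\<beta> \<in> S" and e: "(a, \<beta>, i) \<in> E"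
    using complete \<open>a \<in> S\<close> i unfolding complete_graph_def by blast
  have "Min ((\<lambda>\<alpha>. V \<alpha> ?y) ` S) \<le> V \<beta> ?y"
    using fin \<open>\<beta> \<in> S\<close> by simp
  moreover have "c x (K a *v x) + V \<beta> ?y \<le> V a x"
    by (rule edge[OF e])
  moreover have "V a x \<le> Min ((\<lambda>\<alpha>. V \<alpha> x) ` S)"
    using fin \<open>a \<in> S\<close> least by (subst Min_ge_iff) auto
  ultimately show ?thesis
    by linarith
qed

theorem theorem3:
  fixes M :: nat
    and A :: "nat \<Rightarrow> real^'n^'n"
    and B :: "nat \<Rightarrow> real^'m^'n"
    and c :: "real^'n \<Rightarrow> real^'m \<Rightarrow> real"
    and S :: "'s set"
    and E :: "('s \<times> 's \<times> nat) set"
    and T :: "(real^'n \<Rightarrow> real) set"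
    and V :: "'s \<Rightarrow> real^'n \<Rightarrow> real"
    and K :: "'s \<Rightarrow> real^'n^'m"
    and Vmin :: "real^'n \<Rightarrow> real"
    and \<kappa> :: "real^'n \<Rightarrow> 's"
    and \<phi> :: "real^'n \<Rightarrow> real^'m"
  assumes "M \<ge> 1"
    and "\<And>x u. c x u \<ge> 0"
    and "labeled_graph M S E"
    and "\<And>f x. f \<in> T \<Longrightarrow> f x \<ge> 0"
    and "complete_graph M S E"
    and "V ` S \<subseteq> T"
    and "\<And>x \<alpha> \<beta> i. (\<alpha>, \<beta>, i) \<in> E \<Longrightarrow>
           V \<alpha> x \<ge> c x (K \<alpha> *v x) + V \<beta> (A i *v x + B i *v (K \<alpha> *v x))"
    and "\<And>x. Vmin x = Min ((\<lambda>\<alpha>. V \<alpha> x) ` S)"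
    and "\<And>x. is_arg_min (\<lambda>\<alpha>. V \<alpha> x) (\<lambda>\<alpha>. \<alpha> \<in> S) (\<kappa> x)"
    and "\<And>x. \<phi> x = K (\<kappa> x) *v x"
  shows "\<forall>x. ennreal (Vmin x) \<ge> closed_loop_value M A B c \<phi> x \<and>
             closed_loop_value M A B c \<phi> x \<ge> optimal_value M A B c x"
proof (intro allI conjI)
  fix x
  have fin: "finite S" and ne: "S \<noteq> {}"
    using assms(3) by (auto simp: labeled_graph_def)
  have V_nonneg: "0 \<le> V \<alpha> y" if "\<alpha> \<in> S" for \<alpha> y
    using assms(4,6) that by blast
  have Vmin_nonneg: "0 \<le> Vmin y" for y
    using fin ne V_nonneg by (simp add: assms(8))
  have Vmin_decreases: "c y (\<phi> y) + Vmin (A i *v y + B i *v \<phi> y) \<le> Vmin y"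
    if "i \<in> {1..M}" for y i
    unfolding assms(8,10)
    by (rule min_decreases_under_greedy_policy[OF assms(3,5,7,9) that])
  show "closed_loop_value M A B c \<phi> x \<le> ennreal (Vmin x)"
    by (rule closed_loop_value_le_Lyapunov[where c = c and W = Vmin and \<phi> = \<phi>,
          OF assms(2) Vmin_nonneg Vmin_decreases])
  show "optimal_value M A B c x \<le> closed_loop_value M A B c \<phi> x"
    unfolding optimal_value_def by (rule INF_lower) simp
qed

end
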